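(* Let $A=(A,\cdot,\{\,,\},P)$ be a quasi-Poisson superalgebra. Set $\mathcal{L}(A)=\mathbb{C}[t,t^{-1}]\otimes A$ and for $a\in A$, $n\in\mathbb{Z}$, denote $t^n\otimes a$ by $a_n$. Define a bilinear multiplication $[\,,]$ on $\mathcal{L}(A)$ by $$[a_n,b_m]=n\,(a\cdot P(b))_{n+m}-m\,(P(a)\cdot b)_{n+m}+\{a,b\}_{n+m}\qquad (a,b\in A,\ n,m\in\mathbb{Z}).$$ Then $(\mathcal{L}(A),[\,,])$ is a Lie superalgebra.
   Context: All vector spaces are over $\mathbb{C}$; $p(x)\in\{0,1\}$ denotes the parity of a homogeneous element $x$, and identities are stated for parity-homogeneous elements. The parity on $\mathcal{L}(A)$ is $p(a_n)=p(a)$. A quasi-Poisson superalgebra is a $\mathbb{Z}_2$-graded space $A$ with two bilinear operations $\cdot$ and $\{\,,\}$ and an even endomorphism $P\in\mathrm{End}(A)$ such that: (QP1) $(A,\cdot)$ is a (super)commutative associative unital superalgebra; (QP2) $(A,\{\,,\})$ is a Lie superalgebra; (QP3) $P(a\cdot b)=P(a)\cdot b+a\cdot P(b)-a\cdot b$ for all $a,b\in A$; (QP4) for all $a,b,c\in A$, $$a\cdot P(\{b,c\})=\{a\cdot P(b),c\}+(-1)^{p(a)p(b)}\{b,a\cdot P(c)\}+\{a,b\}\cdot P(c)-(-1)^{p(a)p(b)}P(b)\cdot\{a,c\}.$$ *)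

theory Defs
  imports Complex_Main "HOL-Library.Poly_Mapping" "HOL-Library.Z2"
begin

section \<open>Superspaces and superalgebras\<close>

definition bilinear_map ::
  "(complex \<Rightarrow> 'a::ab_group_add \<Rightarrow> 'a) \<Rightarrow> (complex \<Rightarrow> 'b::ab_group_add \<Rightarrow> 'b) \<Rightarrow>
   (complex \<Rightarrow> 'c::ab_group_add \<Rightarrow> 'c) \<Rightarrow> ('a \<Rightarrow> 'b \<Rightarrow> 'c) \<Rightarrow> bool" where
  "bilinear_map s1 s2 s3 B \<longleftrightarrow>
     (\<forall>x. Vector_Spaces.linear s2 s3 (B x)) \<and> (\<forall>y. Vector_Spaces.linear s1 s3 (\<lambda>x. B x y))"

text \<open>\<open>gr i\<close> is the homogeneous component of parity \<open>i\<close>. The vector 0 lies in both components, which is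
  harmless: the identities below are only required of homogeneous elements and are trivial at 0.\<close>

locale super_space = vector_space scale
  for scale :: "complex \<Rightarrow> 'a::ab_group_add \<Rightarrow> 'a" +
  fixes gr :: "bit \<Rightarrow> 'a set"
  assumes subspace_gr: "subspace (gr i)"
    and gr_sum: "\<exists>y\<in>gr 0. \<exists>z\<in>gr 1. x = y + z"
    and gr_Int: "gr 0 \<inter> gr 1 = {0}"

text \<open>The sign $(-1)^{ij}$.\<close>
definition ksign :: "bit \<Rightarrow> bit \<Rightarrow> complex" where
  "ksign i j = (if i = 1 \<and> j = 1 then -1 else 1)"

locale superalgebra = super_space scale gr
  for scale :: "complex \<Rightarrow> 'a::ab_group_add \<Rightarrow> 'a" and gr :: "bit \<Rightarrow> 'a set" +
  fixes mul :: "'a \<Rightarrow> 'a \<Rightarrow> 'a"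
  assumes mul_bilinear: "bilinear_map scale scale scale mul"
    and mul_graded: "\<lbrakk>a \<in> gr i; b \<in> gr j\<rbrakk> \<Longrightarrow> mul a b \<in> gr (i + j)"

locale comm_assoc_unital_superalgebra = superalgebra scale gr dot
  for scale :: "complex \<Rightarrow> 'a::ab_group_add \<Rightarrow> 'a" and gr :: "bit \<Rightarrow> 'a set"
    and dot :: "'a \<Rightarrow> 'a \<Rightarrow> 'a" +
  assumes dot_commute: "\<lbrakk>a \<in> gr i; b \<in> gr j\<rbrakk> \<Longrightarrow> dot a b = scale (ksign i j) (dot b a)"
    and dot_assoc: "dot (dot a b) c = dot a (dot b c)"
    and dot_unit: "\<exists>e. \<forall>a. dot e a = a \<and> dot a e = a"

locale lie_superalgebra = superalgebra scale gr br
  for scale :: "complex \<Rightarrow> 'a::ab_group_add \<Rightarrow> 'a" and gr :: "bit \<Rightarrow> 'a set"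
    and br :: "'a \<Rightarrow> 'a \<Rightarrow> 'a" +
  assumes br_skew: "\<lbrakk>a \<in> gr i; b \<in> gr j\<rbrakk> \<Longrightarrow> br a b = - scale (ksign i j) (br b a)"
    and br_jacobi: "\<lbrakk>a \<in> gr i; b \<in> gr j; c \<in> gr k\<rbrakk> \<Longrightarrow>
      br a (br b c) = br (br a b) c + scale (ksign i j) (br b (br a c))"

locale quasi_poisson_superalgebra =
  comm_assoc_unital_superalgebra scale gr dot + lie_superalgebra scale gr br
  for scale :: "complex \<Rightarrow> 'a::ab_group_add \<Rightarrow> 'a" and gr :: "bit \<Rightarrow> 'a set"
    and dot :: "'a \<Rightarrow> 'a \<Rightarrow> 'a" and br :: "'a \<Rightarrow> 'a \<Rightarrow> 'a" +
  fixes P :: "'a \<Rightarrow> 'a"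
  assumes P_linear: "Vector_Spaces.linear scale scale P"
    and P_even: "a \<in> gr i \<Longrightarrow> P a \<in> gr i"
    and P_dot: "P (dot a b) = dot (P a) b + dot a (P b) - dot a b"
    and P_br: "\<lbrakk>a \<in> gr i; b \<in> gr j; c \<in> gr k\<rbrakk> \<Longrightarrow>
      dot a (P (br b c)) = br (dot a (P b)) c + scale (ksign i j) (br b (dot a (P c)))
        + dot (br a b) (P c) - scale (ksign i j) (dot (P b) (br a c))"

section \<open>The space $\mathcal{L}(A) = \mathbb{C}[t,t^{-1}] \otimes A$\<close>

text \<open>The tensor product is realised as the type \<open>int \<Rightarrow>\<^sub>0 'a\<close> of finitely supported families in \<open>A\<close>, with
  $t^n \otimes a$ being \<open>Poly_Mapping.single n a\<close>. Laurent polynomials are \<open>int \<Rightarrow>\<^sub>0 complex\<close>.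
  The lemma \<open>loop_tensor_universal\<close> below shows that this is a tensor product.\<close>

definition loop_scale :: "(complex \<Rightarrow> 'a \<Rightarrow> 'a) \<Rightarrow> complex \<Rightarrow> (int \<Rightarrow>\<^sub>0 'a) \<Rightarrow> (int \<Rightarrow>\<^sub>0 'a::zero)" where
  "loop_scale scale c f = Poly_Mapping.map (scale c) f"

definition loop_tensor :: "(complex \<Rightarrow> 'a \<Rightarrow> 'a) \<Rightarrow> (int \<Rightarrow>\<^sub>0 complex) \<Rightarrow> 'a \<Rightarrow> (int \<Rightarrow>\<^sub>0 'a::zero)" where
  "loop_tensor scale p a = Poly_Mapping.map (\<lambda>c. scale c a) p"

definition loop_gr :: "(bit \<Rightarrow> 'a set) \<Rightarrow> bit \<Rightarrow> (int \<Rightarrow>\<^sub>0 'a::zero) set" where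
  "loop_gr gr i = {f. \<forall>n. Poly_Mapping.lookup f n \<in> gr i}"

text \<open>The value of $[a_n, b_m]$, and its biadditive extension; see \<open>loop_bracket_single\<close> and
  \<open>loop_bracket_unique\<close>.\<close>

definition loop_bracket_gen ::
  "(complex \<Rightarrow> 'a::ab_group_add \<Rightarrow> 'a) \<Rightarrow> ('a \<Rightarrow> 'a \<Rightarrow> 'a) \<Rightarrow> ('a \<Rightarrow> 'a \<Rightarrow> 'a) \<Rightarrow> ('a \<Rightarrow> 'a) \<Rightarrow>
   int \<Rightarrow> 'a \<Rightarrow> int \<Rightarrow> 'a \<Rightarrow> (int \<Rightarrow>\<^sub>0 'a)" where
  "loop_bracket_gen scale dot br P n a m b =
     loop_scale scale (of_int n) (Poly_Mapping.single (n + m) (dot a (P b)))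
     - loop_scale scale (of_int m) (Poly_Mapping.single (n + m) (dot (P a) b))
     + Poly_Mapping.single (n + m) (br a b)"

definition loop_bracket ::
  "(complex \<Rightarrow> 'a::ab_group_add \<Rightarrow> 'a) \<Rightarrow> ('a \<Rightarrow> 'a \<Rightarrow> 'a) \<Rightarrow> ('a \<Rightarrow> 'a \<Rightarrow> 'a) \<Rightarrow> ('a \<Rightarrow> 'a) \<Rightarrow>
   (int \<Rightarrow>\<^sub>0 'a) \<Rightarrow> (int \<Rightarrow>\<^sub>0 'a) \<Rightarrow> (int \<Rightarrow>\<^sub>0 'a)" where
  "loop_bracket scale dot br P f g =
     (\<Sum>n\<in>Poly_Mapping.keys f. \<Sum>m\<in>Poly_Mapping.keys g.
        loop_bracket_gen scale dot br P n (Poly_Mapping.lookup f n) m (Poly_Mapping.lookup g m))"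

section \<open>Sanity of the encoding\<close>

lemma lookup_map_0: "h 0 = 0 \<Longrightarrow> Poly_Mapping.lookup (Poly_Mapping.map h f) n = h (Poly_Mapping.lookup f n)"
  by (auto simp: Poly_Mapping.map.rep_eq when_def)

lemma linear_0': "Vector_Spaces.linear s s' h \<Longrightarrow> h 0 = 0"
  by (rule module_hom.zero[of s s']) (simp add: module_hom_iff_linear)

lemma lookup_loop_scale:
  assumes "vector_space scale"
  shows "Poly_Mapping.lookup (loop_scale scale c f) n = scale c (Poly_Mapping.lookup f n)"
  using assms unfolding loop_scale_def
  by (intro lookup_map_0) (simp add: module.scale_zero_right module_iff_vector_space)

lemma lookup_loop_tensor:
  assumes "vector_space scale"
  shows "Poly_Mapping.lookup (loop_tensor scale p a) n = scale (Poly_Mapping.lookup p n) a"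
  using assms unfolding loop_tensor_def
  by (intro lookup_map_0[where h = "\<lambda>c. scale c a"])
     (simp add: module.scale_zero_left module_iff_vector_space)

lemma vector_space_loop_scale:
  assumes "vector_space scale"
  shows "vector_space (loop_scale scale)"
proof -
  interpret vector_space scale by fact
  show ?thesis
    by unfold_locales
       (auto intro!: poly_mapping_eqI
          simp: lookup_loop_scale[OF assms] lookup_add scale_right_distrib scale_left_distrib)
qed

lemma loop_tensor_single:
  assumes "vector_space scale"
  shows "loop_tensor scale (Poly_Mapping.single n 1) a = Poly_Mapping.single n a"
proof -
  interpret vector_space scale by fact
  show ?thesis
    by (auto intro!: poly_mapping_eqI simp: lookup_loop_tensor[OF assms] lookup_single when_def)
qed

lemma sum_single: "(\<Sum>n\<in>Poly_Mapping.keys f. Poly_Mapping.single n (Poly_Mapping.lookup f n)) = f"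
  by (rule poly_mapping_eqI)
     (simp add: lookup_sum lookup_single when_def in_keys_iff)

lemma loop_linear_ext:
  fixes F G :: "(int \<Rightarrow>\<^sub>0 'a::ab_group_add) \<Rightarrow> 'b::ab_group_add"
  assumes "Vector_Spaces.linear (loop_scale scale) s F" "Vector_Spaces.linear (loop_scale scale) s G"
    and eq: "\<And>n a. F (Poly_Mapping.single n a) = G (Poly_Mapping.single n a)"
  shows "F = G"
proof
  fix f :: "int \<Rightarrow>\<^sub>0 'a"
  interpret F: Vector_Spaces.linear "loop_scale scale" s F by fact
  interpret G: Vector_Spaces.linear "loop_scale scale" s G by fact
  let ?f = "\<Sum>n\<in>Poly_Mapping.keys f. Poly_Mapping.single n (Poly_Mapping.lookup f n)"
  have "F ?f = G ?f"
    unfolding F.sum G.sum by (simp add: eq)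
  then show "F f = G f"
    by (simp add: sum_single)
qed

lemma sum_keys_superset:
  assumes "\<And>n. h n 0 = (0::'b::comm_monoid_add)" "finite S" "Poly_Mapping.keys f \<subseteq> S"
  shows "(\<Sum>n\<in>Poly_Mapping.keys f. h n (Poly_Mapping.lookup f n)) = (\<Sum>n\<in>S. h n (Poly_Mapping.lookup f n))"
  using assms by (intro sum.mono_neutral_left) (auto simp: in_keys_iff)

lemma linear_sum_keys:
  assumes vs: "vector_space scale" and lin: "\<And>n. Vector_Spaces.linear scale s (h n)"
  shows "Vector_Spaces.linear (loop_scale scale) s
    (\<lambda>f. \<Sum>n\<in>Poly_Mapping.keys f. h n (Poly_Mapping.lookup f n))"
proof -
  interpret L: vector_space "loop_scale scale" by (rule vector_space_loop_scale) fact
  interpret H: Vector_Spaces.linear scale s "h n" for n by (rule lin)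
  have add: "(\<Sum>n\<in>Poly_Mapping.keys (f + g). h n (Poly_Mapping.lookup (f + g) n))
    = (\<Sum>n\<in>Poly_Mapping.keys f. h n (Poly_Mapping.lookup f n))
    + (\<Sum>n\<in>Poly_Mapping.keys g. h n (Poly_Mapping.lookup g n))" for f g
  proof -
    let ?S = "Poly_Mapping.keys f \<union> Poly_Mapping.keys g"
    note * = sum_keys_superset[where h = h and S = ?S, OF H.zero]
    have "(\<Sum>n\<in>Poly_Mapping.keys (f + g). h n (Poly_Mapping.lookup (f + g) n))
      = (\<Sum>n\<in>?S. h n (Poly_Mapping.lookup (f + g) n))"
      using Poly_Mapping.keys_add[of f g] by (intro *) auto
    moreover have "(\<Sum>n\<in>Poly_Mapping.keys f. h n (Poly_Mapping.lookup f n))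
      = (\<Sum>n\<in>?S. h n (Poly_Mapping.lookup f n))"
      "(\<Sum>n\<in>Poly_Mapping.keys g. h n (Poly_Mapping.lookup g n))
      = (\<Sum>n\<in>?S. h n (Poly_Mapping.lookup g n))"
      by (intro *; auto)+
    ultimately show ?thesis
      by (simp add: lookup_add H.add sum.distrib)
  qed
  have scl: "(\<Sum>n\<in>Poly_Mapping.keys (loop_scale scale c f). h n (Poly_Mapping.lookup (loop_scale scale c f) n))
    = s c (\<Sum>n\<in>Poly_Mapping.keys f. h n (Poly_Mapping.lookup f n))" for c f
  proof -
    note * = sum_keys_superset[where h = h and S = "Poly_Mapping.keys f", OF H.zero]
    have "Poly_Mapping.keys (loop_scale scale c f) \<subseteq> Poly_Mapping.keys f"
      by (auto simp: in_keys_iff lookup_loop_scale[OF vs])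
    from *[OF _ this] show ?thesis
      by (simp add: lookup_loop_scale[OF vs] H.scale H.vs2.scale_sum_right)
  qed
  show ?thesis
    unfolding Vector_Spaces.linear_iff
    using L.vector_space_axioms H.vs2.vector_space_axioms add scl by blast
qed

lemma vector_space_complex: "vector_space ((*) :: complex \<Rightarrow> complex \<Rightarrow> complex)"
  by unfold_locales (auto simp: algebra_simps)

lemma loop_tensor_bilinear:
  assumes vs: "vector_space scale"
  shows "bilinear_map (loop_scale (*)) scale (loop_scale scale) (loop_tensor scale)"
proof -
  interpret vector_space scale by fact
  show ?thesis
    unfolding bilinear_map_def Vector_Spaces.linear_iff
    using vs vector_space_loop_scale[OF vs] vector_space_loop_scale[OF vector_space_complex]
    by (auto intro!: poly_mapping_eqI
        simp: lookup_loop_tensor[OF vs] lookup_loop_scale[OF vs] lookup_add scale_right_distrib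
          scale_left_distrib lookup_loop_scale[OF vector_space_complex] mult.commute)
qed

lemma loop_tensor_universal:
  assumes vs: "vector_space scale" and B: "bilinear_map (loop_scale (*)) scale s B"
  shows "\<exists>!F. Vector_Spaces.linear (loop_scale scale) s F \<and> (\<forall>p a. F (loop_tensor scale p a) = B p a)"
proof (rule ex_ex1I)
  define F where "F = (\<lambda>f. \<Sum>n\<in>Poly_Mapping.keys f. B (Poly_Mapping.single n 1) (Poly_Mapping.lookup f n))"
  have lB1: "Vector_Spaces.linear (loop_scale (*)) s (\<lambda>p. B p a)" for a
    using B by (auto simp: bilinear_map_def)
  have lB2: "Vector_Spaces.linear scale s (B p)" for p
    using B by (auto simp: bilinear_map_def)
  have linF: "Vector_Spaces.linear (loop_scale scale) s F"
    unfolding F_def by (rule linear_sum_keys[OF vs lB2])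
  have Fs: "F (Poly_Mapping.single n a) = B (Poly_Mapping.single n 1) a" for n a
    using linear_0'[OF lB2] by (auto simp: F_def)
  have "F (loop_tensor scale p a) = B p a" for p a
  proof -
    have T: "Vector_Spaces.linear (loop_scale (*)) (loop_scale scale) (\<lambda>p. loop_tensor scale p a)"
      using loop_tensor_bilinear[OF vs] by (auto simp: bilinear_map_def)
    have "Vector_Spaces.linear (loop_scale (*)) s (F \<circ> (\<lambda>p. loop_tensor scale p a))"
      by (rule Vector_Spaces.linear_compose[OF T linF])
    then have "F \<circ> (\<lambda>p. loop_tensor scale p a) = (\<lambda>p. B p a)"
    proof (rule loop_linear_ext[OF _ lB1])
      fix n c
      have s: "Poly_Mapping.single n c = loop_scale (*) c (Poly_Mapping.single n 1)"
        by (rule poly_mapping_eqI)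
           (simp add: lookup_loop_scale[OF vector_space_complex] lookup_single when_def)
      show "(F \<circ> (\<lambda>p. loop_tensor scale p a)) (Poly_Mapping.single n c) = B (Poly_Mapping.single n c) a"
        unfolding s o_def
        using T linF lB1[of a]
        by (simp add: Vector_Spaces.linear_iff loop_tensor_single[OF vs] Fs)
    qed
    then show ?thesis by (simp add: fun_eq_iff)
  qed
  with linF show "\<exists>F. Vector_Spaces.linear (loop_scale scale) s F \<and> (\<forall>p a. F (loop_tensor scale p a) = B p a)"
    by blast
next
  fix F G
  assume "Vector_Spaces.linear (loop_scale scale) s F \<and> (\<forall>p a. F (loop_tensor scale p a) = B p a)"
    and "Vector_Spaces.linear (loop_scale scale) s G \<and> (\<forall>p a. G (loop_tensor scale p a) = B p a)"
  then show "F = G"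
    by (intro loop_linear_ext) (auto simp flip: loop_tensor_single[OF vs])
qed

lemma loop_bracket_gen_linear:
  assumes "quasi_poisson_superalgebra scale gr dot br P"
  shows "Vector_Spaces.linear scale (loop_scale scale) (\<lambda>a. loop_bracket_gen scale dot br P n a m b)"
    and "Vector_Spaces.linear scale (loop_scale scale) (\<lambda>b. loop_bracket_gen scale dot br P n a m b)"
proof -
  interpret quasi_poisson_superalgebra scale gr dot br P by fact
  note vs = vector_space_axioms
  have lin: "Vector_Spaces.linear scale scale (dot x)" "Vector_Spaces.linear scale scale (\<lambda>x. dot x y)"
    "Vector_Spaces.linear scale scale (br x)" "Vector_Spaces.linear scale scale (\<lambda>x. br x y)" for x y
    using comm_assoc_unital_superalgebra_axioms lie_superalgebra_axioms
    by (auto simp: comm_assoc_unital_superalgebra_def lie_superalgebra_def superalgebra_def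
        superalgebra_axioms_def bilinear_map_def)
  note sum = lin[unfolded Vector_Spaces.linear_iff, THEN conjunct2, THEN conjunct2]
    P_linear[unfolded Vector_Spaces.linear_iff, THEN conjunct2, THEN conjunct2]
  show "Vector_Spaces.linear scale (loop_scale scale) (\<lambda>a. loop_bracket_gen scale dot br P n a m b)"
    and "Vector_Spaces.linear scale (loop_scale scale) (\<lambda>b. loop_bracket_gen scale dot br P n a m b)"
    unfolding Vector_Spaces.linear_iff loop_bracket_gen_def
    using vs vector_space_loop_scale[OF vs]
    by (auto intro!: poly_mapping_eqI
        simp: lookup_loop_scale[OF vs] lookup_add lookup_minus lookup_single when_def sum
          scale_right_distrib scale_right_diff_distrib mult.commute)
qed

lemma loop_bracket_single:
  assumes "quasi_poisson_superalgebra scale gr dot br P"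
  shows "loop_bracket scale dot br P (Poly_Mapping.single n a) (Poly_Mapping.single m b) =
     loop_scale scale (of_int n) (Poly_Mapping.single (n + m) (dot a (P b)))
     - loop_scale scale (of_int m) (Poly_Mapping.single (n + m) (dot (P a) b))
     + Poly_Mapping.single (n + m) (br a b)"
  unfolding loop_bracket_gen_def[symmetric]
  using loop_bracket_gen_linear[OF assms, THEN linear_0']
  by (auto simp: loop_bracket_def)

lemma loop_bracket_bilinear:
  assumes "quasi_poisson_superalgebra scale gr dot br P"
  shows "bilinear_map (loop_scale scale) (loop_scale scale) (loop_scale scale) (loop_bracket scale dot br P)"
proof -
  interpret quasi_poisson_superalgebra scale gr dot br P by fact
  note vs = vector_space_axioms
  interpret L: vector_space "loop_scale scale" by (rule vector_space_loop_scale[OF vs])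
  interpret LL: vector_space_pair scale "loop_scale scale" by unfold_locales
  note g = loop_bracket_gen_linear[OF assms]
  show ?thesis
    unfolding bilinear_map_def
  proof (intro conjI allI)
    fix f
    show "Vector_Spaces.linear (loop_scale scale) (loop_scale scale) (loop_bracket scale dot br P f)"
      unfolding loop_bracket_def
      by (subst sum.swap, rule linear_sum_keys[OF vs]) (intro LL.linear_compose_sum ballI g)
  next
    fix g'
    show "Vector_Spaces.linear (loop_scale scale) (loop_scale scale) (\<lambda>f. loop_bracket scale dot br P f g')"
      unfolding loop_bracket_def
      by (rule linear_sum_keys[OF vs]) (intro LL.linear_compose_sum ballI g)
  qed
qed

lemma loop_bracket_unique:
  assumes qp: "quasi_poisson_superalgebra scale gr dot br P"
    and B: "bilinear_map (loop_scale scale) (loop_scale scale) (loop_scale scale) B"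
    and gen: "\<And>n a m b. B (Poly_Mapping.single n a) (Poly_Mapping.single m b) =
     loop_scale scale (of_int n) (Poly_Mapping.single (n + m) (dot a (P b)))
     - loop_scale scale (of_int m) (Poly_Mapping.single (n + m) (dot (P a) b))
     + Poly_Mapping.single (n + m) (br a b)"
  shows "B = loop_bracket scale dot br P"
proof -
  note C = loop_bracket_bilinear[OF qp]
  have 1: "B (Poly_Mapping.single n a) = loop_bracket scale dot br P (Poly_Mapping.single n a)" for n a
    using B C unfolding bilinear_map_def
    by (intro loop_linear_ext[of scale "loop_scale scale"]) (auto simp: gen loop_bracket_single[OF qp])
  have "(\<lambda>f. B f g) = (\<lambda>f. loop_bracket scale dot br P f g)" for g
    using B C unfolding bilinear_map_def
    by (intro loop_linear_ext[of scale "loop_scale scale"]) (auto simp: 1)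
  then show ?thesis by (metis ext)
qed

end

(* On monomials all terms of the super Jacobi identity sit in the same degree, and after expansion
   it is a polynomial identity in the three exponents with coefficients in A. The quadratic part
   follows from (QP1) and (QP3) and the constant part is the Jacobi identity of A. The three linear
   parts are all instances of (QP4): as it stands for the first exponent, with the first two
   elements exchanged for the second, and with the last element moved to the front for the third. *)
theory Submission
  imports Defs
begin

section \<open>Signs and bilinear operations\<close>

lemma ksign_sym: "ksign i j = ksign j i"
  by (simp add: ksign_def)

lemma ksign_square: "ksign i j * ksign i j = 1"
  by (simp add: ksign_def)

text \<open>The sign is a bicharacter: passing a product costs one factor for each of its
  entries.\<close>

lemma ksign_add_left: "ksign (i + j) k = ksign i k * ksign j k"
  by (cases i; cases j; cases k) (simp_all add: ksign_def)

context superalgebra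
begin

lemma mul_linear: "Vector_Spaces.linear scale scale (mul x)"
    "Vector_Spaces.linear scale scale (\<lambda>x. mul x y)"
  using mul_bilinear by (auto simp: bilinear_map_def)

lemma mul_add:
  "mul (x + x') y = mul x y + mul x' y" "mul x (y + y') = mul x y + mul x y'"
  using mul_linear by (auto simp: Vector_Spaces.linear_iff)

lemma mul_scale:
  "mul (scale r x) y = scale r (mul x y)" "mul x (scale r y) = scale r (mul x y)"
  using mul_linear by (auto simp: Vector_Spaces.linear_iff)

lemma mul_diff:
  "mul (x - x') y = mul x y - mul x' y" "mul x (y - y') = mul x y - mul x y'"
  using mul_add(1)[of "x - x'" x' y] mul_add(2)[of x "y - y'" y'] by (simp_all add: algebra_simps)

lemma mul_minus:
  "mul (- x) y = - mul x y" "mul x (- y) = - mul x y"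
  \<comment> \<open>The instances with both entries 0 supply \<open>mul 0 y = 0\<close> and
    \<open>mul x 0 = 0\<close>.\<close>
  using mul_diff(1)[of 0 x y] mul_diff(1)[of 0 0 y] mul_diff(2)[of x 0 y] mul_diff(2)[of x 0 0]
  by simp_all

end

section \<open>Consequences of the quasi-Poisson axioms\<close>

context quasi_poisson_superalgebra
begin

lemma superalgebra_dot: "superalgebra scale gr dot"
  using comm_assoc_unital_superalgebra_axioms by (simp add: comm_assoc_unital_superalgebra_def)

lemma superalgebra_br: "superalgebra scale gr br"
  using lie_superalgebra_axioms by (simp add: lie_superalgebra_def)

lemmas dot_graded = superalgebra.mul_graded[OF superalgebra_dot]
  and dot_add = superalgebra.mul_add[OF superalgebra_dot]
  and dot_diff = superalgebra.mul_diff[OF superalgebra_dot]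
  and dot_minus = superalgebra.mul_minus[OF superalgebra_dot]
  and dot_scale = superalgebra.mul_scale[OF superalgebra_dot]
  and br_graded = superalgebra.mul_graded[OF superalgebra_br]
  and br_add = superalgebra.mul_add[OF superalgebra_br]
  and br_diff = superalgebra.mul_diff[OF superalgebra_br]
  and br_scale = superalgebra.mul_scale[OF superalgebra_br]

text \<open>This fact and the next two are oriented so that rewriting absorbs the sign and restores
  the order \<open>a\<close>, \<open>b\<close>.\<close>

lemma br_commute_scaled:
  assumes "a \<in> gr i" "b \<in> gr j"
  shows "scale (ksign i j) (br b a) = - br a b"
  using br_skew[OF assms] by simp

lemma dot_commute_scaled:
  assumes "a \<in> gr i" "b \<in> gr j"
  shows "scale (ksign i j) (dot b a) = dot a b"
  using dot_commute[OF assms] by simp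

lemma dot_left_commute_scaled:
  assumes "a \<in> gr i" "b \<in> gr j"
  shows "scale (ksign i j) (dot b (dot a c)) = dot a (dot b c)"
  using dot_scale(1)[of "ksign i j" "dot b a" c] by (simp add: dot_assoc dot_commute_scaled[OF assms])

lemma P_add: "P (a + b) = P a + P b"
  and P_scale: "P (scale r a) = scale r (P a)"
  using P_linear by (auto simp: Vector_Spaces.linear_iff)

lemma P_diff: "P (a - b) = P a - P b"
  using P_add[of "a - b" b] by (simp add: algebra_simps)

text \<open>(QP4) for the triple \<open>b\<close>, \<open>a\<close>, \<open>c\<close>, multiplied by
  \<open>ksign i j\<close>: on each term the sign either squares to 1 or reverses one product. It
  settles the terms linear in the exponent of \<open>b\<close>.\<close>

lemma P_br_swap:
  assumes a: "a \<in> gr i" and b: "b \<in> gr j" and c: "c \<in> gr k"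
  shows "scale (ksign i j) (dot b (P (br a c))) =
    br (dot (P a) b) c + br a (dot b (P c)) - dot (br a b) (P c) - dot (P a) (br b c)"
proof -
  have "scale (ksign i j) (dot b (P (br a c))) = br (scale (ksign i j) (dot b (P a))) c
      + br a (dot b (P c)) + dot (scale (ksign i j) (br b a)) (P c) - dot (P a) (br b c)"
    unfolding P_br[OF b a c]
    by (simp add: scale_right_distrib scale_right_diff_distrib ksign_sym[of j i] ksign_square
        dot_scale br_scale)
  then show ?thesis
    using dot_commute_scaled[OF P_even[OF a] b] br_commute_scaled[OF a b] by (simp add: dot_minus)
qed

text \<open>(QP4) for the triple \<open>c\<close>, \<open>a\<close>, \<open>b\<close>, with
  \<open>c\<close> then moved back to the end of every term. It settles the terms linear in the
  exponent of \<open>c\<close>.\<close>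

lemma P_br_last:
  assumes a: "a \<in> gr i" and b: "b \<in> gr j" and c: "c \<in> gr k"
  shows "dot (P (br a b)) c =
    br a (dot (P b) c) - scale (ksign i j) (br b (dot (P a) c))
    - scale (ksign i j) (dot (P b) (br a c)) + dot (P a) (br b c)"
proof -
  note Pa = P_even[OF a] and Pb = P_even[OF b]
  let ?s = "ksign i j" and ?t = "ksign i k" and ?u = "ksign j k"
  have "dot (P (br a b)) c = scale (?t * ?u) (dot c (P (br a b)))"
    using dot_commute[OF P_even[OF br_graded[OF a b]] c, unfolded ksign_add_left] by simp
  \<comment> \<open>The signs are distributed so that each stands directly on a product that it
    reorders; the second \<open>?t\<close> cancels against the one in (QP4).\<close>
  also have "\<dots> = scale ?u (br (scale ?t (dot c (P a))) b) + br a (scale ?u (dot c (P b)))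
      + scale ?u (dot (scale ?t (br c a)) (P b)) - dot (P a) (scale ?u (br c b))"
    unfolding P_br[OF c a b]
    by (simp add: scale_right_distrib scale_right_diff_distrib ksign_sym[of k i] ksign_square
        dot_scale br_scale mult.commute mult.left_commute mult.assoc[symmetric])
  also have "\<dots> = scale ?u (br (dot (P a) c) b) + br a (dot (P b) c)
      - scale ?u (dot (br a c) (P b)) + dot (P a) (br b c)"
    by (simp add: dot_minus dot_commute_scaled[OF Pa c] dot_commute_scaled[OF Pb c]
        br_commute_scaled[OF a c] br_commute_scaled[OF b c])
  \<comment> \<open>Moving \<open>b\<close> past an element of parity \<open>i + k\<close> costs
    \<open>?s\<close> and \<open>?u\<close>; the latter cancels the factor in front.\<close>
  also have "scale ?u (br (dot (P a) c) b) = - scale ?s (br b (dot (P a) c))"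
    by (simp add: br_skew[OF dot_graded[OF Pa c] b, unfolded ksign_add_left] ksign_sym[of k j]
        mult.left_commute[of _ "ksign i j"] ksign_square)
  also have "scale ?u (dot (br a c) (P b)) = scale ?s (dot (P b) (br a c))"
    by (simp add: dot_commute[OF br_graded[OF a c] Pb, unfolded ksign_add_left] ksign_sym[of k j]
        mult.left_commute[of _ "ksign i j"] ksign_square)
  finally show ?thesis by simp
qed

text \<open>The exponents are complex numbers here, so that the Jacobi identity becomes polynomial in them.\<close>
definition coeff_br :: "complex \<Rightarrow> 'a \<Rightarrow> complex \<Rightarrow> 'a \<Rightarrow> 'a" where
  "coeff_br r a q b = scale r (dot a (P b)) - scale q (dot (P a) b) + br a b"

text \<open>Supercommutativity exchanges the two product terms, whose opposite signs give the
  skew-symmetry; \<open>P\<close> is even, so the sign remains \<open>ksign i j\<close>.\<close>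

lemma coeff_br_skew:
  assumes a: "a \<in> gr i" and b: "b \<in> gr j"
  shows "coeff_br r a q b = - scale (ksign i j) (coeff_br q b r a)"
  unfolding coeff_br_def
  by (simp add: dot_commute[OF a P_even[OF b]] dot_commute[OF P_even[OF a] b] br_skew[OF a b]
     scale_right_distrib scale_right_diff_distrib mult.commute)

text \<open>The exponents \<open>m + l\<close>, \<open>n + m\<close> and \<open>n + l\<close> are
  the degrees of the inner brackets, so this is the Jacobi identity for three monomials.\<close>

lemma coeff_br_jacobi:
  assumes a: "a \<in> gr i" and b: "b \<in> gr j" and c: "c \<in> gr k"
  shows "coeff_br n a (m + l) (coeff_br m b l c) =
    coeff_br (n + m) (coeff_br n a m b) l c
    + scale (ksign i j) (coeff_br m b (n + l) (coeff_br n a l c))"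
proof -
  note Pa = P_even[OF a] and Pb = P_even[OF b]
  note PPa = P_even[OF Pa]
  let ?s = "ksign i j"
  \<comment> \<open>Only this term has \<open>b\<close> before \<open>a\<close>. Its triple products
    are put in the order \<open>a\<close>, \<open>b\<close>, \<open>c\<close>, after which
    associativity suffices to compare products.\<close>
  have "scale ?s (coeff_br m b (n + l) (coeff_br n a l c)) =
      scale (m * n) (dot (P a) (dot b (P c)) + dot a (dot b (P (P c))) - dot a (dot b (P c)))
      - scale (m * l) (dot (P (P a)) (dot b c) + dot (P a) (dot b (P c)) - dot (P a) (dot b c))
      + scale m (scale ?s (dot b (P (br a c))))
      - scale (n + l) (scale n (dot a (dot (P b) (P c))) - scale l (dot (P a) (dot (P b) c))
        + scale ?s (dot (P b) (br a c)))
      + scale n (scale ?s (br b (dot a (P c)))) - scale l (scale ?s (br b (dot (P a) c)))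
      + scale ?s (br b (br a c))"
    unfolding coeff_br_def
      dot_left_commute_scaled[OF a b, symmetric] dot_left_commute_scaled[OF Pa b, symmetric]
      dot_left_commute_scaled[OF PPa b, symmetric]
      dot_left_commute_scaled[OF a Pb, symmetric] dot_left_commute_scaled[OF Pa Pb, symmetric]
    by (simp add: P_add P_diff P_scale P_dot dot_add dot_diff dot_scale br_add br_diff
        br_scale scale_right_distrib scale_right_diff_distrib mult_ac)
  then show ?thesis
    \<comment> \<open>This precedes the simplification, which would merge \<open>?s\<close> with the
      scalar \<open>m\<close> and hide the pattern.\<close>
    unfolding P_br_swap[OF a b c]
    unfolding coeff_br_def
    by (simp add: P_add P_diff P_scale P_dot dot_add dot_diff dot_scale br_add br_diff
        br_scale dot_assoc P_br[OF a b c] P_br_last[OF a b c] br_jacobi[OF a b c]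
        scale_right_distrib scale_right_diff_distrib scale_left_distrib algebra_simps)
qed

end

section \<open>Monomials and the grading of the loop space\<close>

lemma loop_bracket_single_coeff_br:
  assumes "quasi_poisson_superalgebra scale gr dot br P"
  shows "loop_bracket scale dot br P (Poly_Mapping.single n a) (Poly_Mapping.single m b) =
    Poly_Mapping.single (n + m)
      (quasi_poisson_superalgebra.coeff_br scale dot br P (of_int n) a (of_int m) b)"
proof -
  interpret quasi_poisson_superalgebra scale gr dot br P by fact
  show ?thesis
    by (rule poly_mapping_eqI)
      (simp add: loop_bracket_single[OF assms] coeff_br_def lookup_add lookup_minus
        lookup_loop_scale[OF vector_space_axioms] lookup_single when_def)
qed

text \<open>A homogeneous \<open>f\<close> is the finite sum of its components, all of the same
  parity, so additive properties reduce to monomials.\<close>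

lemma loop_gr_induct [consumes 1, case_names zero single add]:
  fixes gr :: "bit \<Rightarrow> 'a::ab_group_add set"
  assumes f: "f \<in> loop_gr gr i"
    and "Q 0" "\<And>n a. a \<in> gr i \<Longrightarrow> Q (Poly_Mapping.single n a)"
    and "\<And>f g. Q f \<Longrightarrow> Q g \<Longrightarrow> Q (f + g)"
  shows "Q f"
proof -
  have "Q (\<Sum>n\<in>S. Poly_Mapping.single n (Poly_Mapping.lookup f n))" if "finite S" for S
    using that f assms(2-) by (induction S) (auto simp: loop_gr_def)
  from this[OF finite_keys[of f]] show ?thesis
    by (simp add: sum_single)
qed

lemma super_space_loop:
  assumes "super_space scale gr"
  shows "super_space (loop_scale scale) (loop_gr gr)"
proof -
  interpret super_space scale gr by fact
  interpret L: vector_space "loop_scale scale"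
    by (rule vector_space_loop_scale[OF vector_space_axioms])
  have sub: "L.subspace (loop_gr gr i)" for i
    using subspace_gr[of i]
    by (auto simp: L.subspace_def subspace_def loop_gr_def lookup_add
        lookup_loop_scale[OF vector_space_axioms])
  show ?thesis
  proof
    show "L.subspace (loop_gr gr i)" for i by (rule sub)
    show "\<exists>y\<in>loop_gr gr 0. \<exists>z\<in>loop_gr gr 1. x = y + z" for x
    proof -
      \<comment> \<open>With the full space as every component, the induction applies to arbitrary
        elements.\<close>
      have "x \<in> loop_gr (\<lambda>_. UNIV) 0" by (simp add: loop_gr_def)
      then show ?thesis
      proof (induction rule: loop_gr_induct)
        case zero
        show ?case using sub by (metis L.subspace_0 add_0)
      next
        case (single n a)
        obtain y z where "y \<in> gr 0" "z \<in> gr 1" "a = y + z" using gr_sum by blast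
        then show ?case
          using subspace_gr
          by (intro bexI[of _ "Poly_Mapping.single n y"] bexI[of _ "Poly_Mapping.single n z"])
            (auto simp: loop_gr_def single_add lookup_single when_def subspace_0)
      next
        case (add f g)
        then obtain y z y' z' where "y \<in> loop_gr gr 0" "z \<in> loop_gr gr 1" "f = y + z"
          "y' \<in> loop_gr gr 0" "z' \<in> loop_gr gr 1" "g = y' + z'" by blast
        then show ?case
          by (intro bexI[of _ "y + y'"] bexI[of _ "z + z'"])
            (auto simp: add_ac L.subspace_add[OF sub])
      qed
    qed
    show "loop_gr gr 0 \<inter> loop_gr gr 1 = {0}"
      using gr_Int subspace_gr[THEN subspace_0]
      by (fastforce simp: loop_gr_def intro: poly_mapping_eqI)
  qed
qed

theorem theorem6p7:
  fixes scale :: "complex \<Rightarrow> 'a::ab_group_add \<Rightarrow> 'a"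
    and gr :: "bit \<Rightarrow> 'a set"
    and dot br :: "'a \<Rightarrow> 'a \<Rightarrow> 'a"
    and P :: "'a \<Rightarrow> 'a"
  assumes "quasi_poisson_superalgebra scale gr dot br P"
  shows "lie_superalgebra (loop_scale scale) (loop_gr gr) (loop_bracket scale dot br P)"
proof -
  interpret quasi_poisson_superalgebra scale gr dot br P by fact
  let ?L = "loop_bracket scale dot br P"
  note bracket_single = loop_bracket_single_coeff_br[OF assms]
  interpret S: super_space "loop_scale scale" "loop_gr gr"
    by (rule super_space_loop[OF super_space_axioms])
  note bil = loop_bracket_bilinear[OF assms]
  have zero: "?L 0 g = 0" "?L f 0 = 0" for f g
    by (simp_all add: loop_bracket_def)
  have add: "?L (f + f') g = ?L f g + ?L f' g" "?L f (g + g') = ?L f g + ?L f g'" for f f' g g'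
    using bil by (auto simp: bilinear_map_def Vector_Spaces.linear_iff)
  have coeff_gr: "coeff_br r a q b \<in> gr (i + j)" if "a \<in> gr i" "b \<in> gr j" for r q a b i j
    unfolding coeff_br_def using that
    by (intro subspace_add subspace_diff subspace_scale subspace_gr dot_graded br_graded P_even)
  have scale_single: "loop_scale scale r (Poly_Mapping.single n a) = Poly_Mapping.single n (scale r a)"
    for r n a
    by (rule poly_mapping_eqI)
      (simp add: lookup_loop_scale[OF vector_space_axioms] lookup_single when_def)
  show ?thesis
  proof
    show "bilinear_map (loop_scale scale) (loop_scale scale) (loop_scale scale) ?L" by (rule bil)
  next
    fix f g i j assume f: "f \<in> loop_gr gr i" and g: "g \<in> loop_gr gr j"
    note S0 = S.subspace_0[OF S.subspace_gr] and Sadd = S.subspace_add[OF S.subspace_gr]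
    \<comment> \<open>This claim and the two after it are preserved under addition in each argument,
      so nested inductions leave only monomials.\<close>
    from f show "?L f g \<in> loop_gr gr (i + j)"
    proof (induction rule: loop_gr_induct)
      case f: (single n a)
      from g show ?case
      proof (induction rule: loop_gr_induct)
        case (single m b)
        then show ?case
          using coeff_gr[OF f] subspace_0[OF subspace_gr]
          by (auto simp: bracket_single loop_gr_def lookup_single when_def)
      qed (auto simp: zero add S0 Sadd)
    qed (auto simp: zero add S0 Sadd)
    from f show "?L f g = - loop_scale scale (ksign i j) (?L g f)"
    proof (induction rule: loop_gr_induct)
      case f: (single n a)
      from g show ?case
      proof (induction rule: loop_gr_induct)
        case (single m b)
        then show ?case
          using coeff_br_skew[OF f]
          by (simp add: bracket_single scale_single add.commute single_uminus)
      qed (auto simp: zero add S.scale_right_distrib)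
    qed (auto simp: zero add S.scale_right_distrib)
  next
    fix f g h i j k
    assume f: "f \<in> loop_gr gr i" and g: "g \<in> loop_gr gr j" and h: "h \<in> loop_gr gr k"
    from f show "?L f (?L g h) = ?L (?L f g) h + loop_scale scale (ksign i j) (?L g (?L f h))"
    proof (induction rule: loop_gr_induct)
      case f: (single n a)
      from g show ?case
      proof (induction rule: loop_gr_induct)
        case g: (single m b)
        from h show ?case
        proof (induction rule: loop_gr_induct)
          case (single l c)
          then show ?case
            \<comment> \<open>All three terms have total degree \<open>n + m + l\<close>, so the two
              monomials on the right merge into one and coefficients can be compared.\<close>
            using coeff_br_jacobi[OF f g, of c k "of_int n" "of_int m" "of_int l"]
            by (simp add: bracket_single scale_single add_ac single_add[symmetric])
        qed (auto simp: zero add S.scale_right_distrib)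
      qed (auto simp: zero add S.scale_right_distrib)
    qed (auto simp: zero add S.scale_right_distrib)
  qed
qed

end
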